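(* Let $\mathcal{H}$ be a pseudohalfplane hypergraph on a finite totally ordered vertex set $V$ with $|V|=n\ge 3$. If every subset of $3$ vertices of $V$ is contained in some hyperedge $H\in\mathcal{H}$, then there exist at most two hyperedges of $\mathcal{H}$ whose union is $V$.
   Context: A hypergraph $\mathcal{F}$ on a totally ordered finite vertex set $V$ (a family of subsets of $V$) is ABA-free if there are no two hyperedges $A,B\in\mathcal{F}$ and vertices $x<y<z$ with $x,z\in A\setminus B$ and $y\in B\setminus A$. For a family $\mathcal{F}$ of subsets of $V$ let $\bar{\mathcal{F}}=\{V\setminus F: F\in\mathcal{F}\}$. A hypergraph $\mathcal{H}$ on $V$ is a pseudohalfplane hypergraph if there exists an ABA-free hypergraph $\mathcal{F}$ on $V$ such that $\mathcal{H}\subseteq\mathcal{F}\cup\bar{\mathcal{F}}$. *)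

theory Defs
  imports Main
begin

text \<open>A hypergraph on a finite vertex set \<open>V\<close> is a family of subsets of \<open>V\<close>, without
  multiplicities; the empty hyperedge is allowed. The vertex order is the order of the ambient
  linearly ordered type, restricted to \<open>V\<close>.\<close>

definition hypergraph_on :: "'a set \<Rightarrow> 'a set set \<Rightarrow> bool" where
  "hypergraph_on V F \<longleftrightarrow> F \<subseteq> Pow V"

definition ABA_free :: "'a::linorder set set \<Rightarrow> bool" where
  "ABA_free F \<longleftrightarrow>
     \<not> (\<exists>A\<in>F. \<exists>B\<in>F. \<exists>x y z. x < y \<and> y < z \<and> x \<in> A - B \<and> z \<in> A - B \<and> y \<in> B - A)"

definition complement_family :: "'a set \<Rightarrow> 'a set set \<Rightarrow> 'a set set" where
  "complement_family V F = {V - A | A. A \<in> F}"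

definition pseudohalfplane_hypergraph :: "'a::linorder set \<Rightarrow> 'a set set \<Rightarrow> bool" where
  "pseudohalfplane_hypergraph V H \<longleftrightarrow>
     hypergraph_on V H \<and>
     (\<exists>F. hypergraph_on V F \<and> ABA_free F \<and> H \<subseteq> F \<union> complement_family V F)"

end

(* Pass to complements: if no two hyperedges cover V, their complements pairwise intersect, and it
   suffices to hit all complements with three vertices.

   Call a vertex unskippable if no member of the ABA-free family F misses it while having elements
   on both sides of it; unskippable vertices behave like the vertices of the upper convex hull.
   If {Min V, Max V} does not hit all complements, then, after possibly exchanging F with the family
   of its complements, some X in F to be hit misses both Min V and Max V. Choose X so that its trace
   on the unskippable vertices is minimal. The trace is a nonempty interval; its first vertex
   together with its two neighbouring unskippable vertices is the desired hitting set. *)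

theory Submission
  imports Defs
begin

section \<open>Skipped vertices and elementary facts on ABA-free families\<close>

definition skips :: "'a::linorder set \<Rightarrow> 'a \<Rightarrow> bool" where
  "skips A v \<longleftrightarrow> v \<notin> A \<and> (\<exists>x\<in>A. x < v) \<and> (\<exists>z\<in>A. v < z)"

lemma ABA_freeD:
  assumes "ABA_free F" "A \<in> F" "B \<in> F" "x < y" "y < z"
    and "x \<in> A" "x \<notin> B" "z \<in> A" "z \<notin> B" "y \<in> B"
  shows "y \<in> A"
  using assms unfolding ABA_free_def by blast

lemma ABA_free_subset: "ABA_free F \<Longrightarrow> F' \<subseteq> F \<Longrightarrow> ABA_free F'"
  unfolding ABA_free_def by blast

lemma ABA_free_insertI:
  assumes "ABA_free F"
    and "\<And>C x y z. \<lbrakk>C \<in> F; x < y; y < z; x \<in> A - C; z \<in> A - C; y \<in> C - A\<rbrakk> \<Longrightarrow> False"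
    and "\<And>C x y z. \<lbrakk>C \<in> F; x < y; y < z; x \<in> C - A; z \<in> C - A; y \<in> A - C\<rbrakk> \<Longrightarrow> False"
  shows "ABA_free (insert A F)"
  unfolding ABA_free_def
proof clarify
  fix B C x y z
  assume "B \<in> insert A F" "C \<in> insert A F" and xyz: "x < y" "y < z"
    and mem: "x \<in> B" "x \<notin> C" "z \<in> B" "z \<notin> C" "y \<in> C" "y \<notin> B"
  then consider "B = A" "C \<in> F" | "C = A" "B \<in> F" | "B \<in> F" "C \<in> F"
    by blast
  then show False
  proof cases
    case 1
    then show False
      using assms(2)[of C x y z] xyz mem by simp
  next
    case 2
    then show False
      using assms(3)[of B x y z] xyz mem by simp
  next
    case 3
    then show False
      using ABA_freeD[OF assms(1), of B C x y z] xyz mem by simp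
  qed
qed

section \<open>Complement families\<close>

text \<open>Since \<open>(V - A) - (V - B) = B - A\<close>, complementation merely exchanges the
  roles of the two sets in a forbidden pattern.\<close>

lemma ABA_free_complement_family:
  assumes "F \<subseteq> Pow V" "ABA_free F"
  shows "ABA_free (complement_family V F)"
proof -
  have eq: "V - A - (V - B) = B - A" if "B \<in> F" for A B
    using that assms(1) by blast
  show ?thesis
    unfolding ABA_free_def
  proof clarify
    fix A' B' x y z
    assume "A' \<in> complement_family V F" "B' \<in> complement_family V F" and xyz: "x < y" "y < z"
      and mem: "x \<in> A'" "x \<notin> B'" "z \<in> A'" "z \<notin> B'" "y \<in> B'" "y \<notin> A'"
    then obtain A B where AB: "A \<in> F" "B \<in> F" "A' = V - A" "B' = V - B"
      unfolding complement_family_def by blast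
    then have "x \<in> B - A" "z \<in> B - A" "y \<in> A - B"
      using mem eq[of A B] eq[of B A] by auto
    then show False
      using ABA_freeD[OF assms(2) AB(2,1) xyz] by blast
  qed
qed

lemma complement_family_eq_image: "complement_family V F = (-) V ` F"
  unfolding complement_family_def by auto

lemma complement_family_Un:
  "complement_family V (F \<union> F') = complement_family V F \<union> complement_family V F'"
  unfolding complement_family_eq_image by (rule image_Un)

lemma complement_family_mono:
  "F \<subseteq> F' \<Longrightarrow> complement_family V F \<subseteq> complement_family V F'"
  unfolding complement_family_eq_image by (rule image_mono)

lemma complement_family_involutive:
  assumes "F \<subseteq> Pow V"
  shows "complement_family V (complement_family V F) = F"
proof -
  have "V - (V - A) = A" if "A \<in> F" for A
    using that assms by blast
  then have "(\<lambda>A. V - (V - A)) ` F = id ` F"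
    by (intro image_cong) simp_all
  then show ?thesis
    unfolding complement_family_eq_image by (simp add: image_image)
qed

section \<open>Existence of unskippable vertices\<close>

text \<open>A new forbidden pattern can only arise when \<open>x\<close> was cut off from
  \<open>B\<close>. Then \<open>C\<close> has the elements \<open>x\<close> and \<open>z\<close> on
  both sides of \<open>u\<close>, so it contains the unskipped \<open>u\<close>; as \<open>u\<close>
  is not in \<open>B\<close>, it replaces \<open>x\<close> in a pattern of \<open>C\<close> and the
  uncut \<open>B\<close>.\<close>

lemma ABA_free_insert_Int_greaterThan:
  assumes "ABA_free (insert B F)" "u \<notin> B" "\<forall>C\<in>F. \<not> skips C u"
  shows "ABA_free (insert (B \<inter> {u<..}) F)"
proof (rule ABA_free_insertI)
  show "ABA_free F"
    using assms(1) by (rule ABA_free_subset) blast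
next
  fix C x y z
  assume C: "C \<in> F" and "x < y" "y < z"
    and "x \<in> B \<inter> {u<..} - C" "z \<in> B \<inter> {u<..} - C" "y \<in> C - B \<inter> {u<..}"
  then show False
    using ABA_freeD[OF assms(1), of B C x y z] by auto
next
  fix C x y z
  assume C: "C \<in> F" and xy: "x < y" and yz: "y < z"
    and x: "x \<in> C - B \<inter> {u<..}" and z: "z \<in> C - B \<inter> {u<..}" and y: "y \<in> B \<inter> {u<..} - C"
  have zB: "z \<notin> B" and uy: "u < y"
    using y yz z by auto
  show False
  proof (cases "x \<in> B")
    case False
    then show False
      using ABA_freeD[OF assms(1), of C B x y z] C x y z zB xy yz by auto
  next
    case True
    then have "x < u"
      using x assms(2) by (metis DiffD2 IntI greaterThan_iff linorder_neqE)
    moreover have "u < z"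
      using uy yz by (rule less_trans)
    ultimately have "u \<in> C"
      using assms(3) C x z unfolding skips_def by blast
    then show False
      using ABA_freeD[OF assms(1), of C B u y z] C y z zB uy yz assms(2) by auto
  qed
qed

text \<open>Mirror image of the preceding argument: here \<open>z\<close> may have been cut off, and
  \<open>u\<close> replaces it.\<close>

lemma ABA_free_insert_Int_lessThan:
  assumes "ABA_free (insert B F)" "u \<notin> B" "\<forall>C\<in>F. \<not> skips C u"
  shows "ABA_free (insert (B \<inter> {..<u}) F)"
proof (rule ABA_free_insertI)
  show "ABA_free F"
    using assms(1) by (rule ABA_free_subset) blast
next
  fix C x y z
  assume C: "C \<in> F" and "x < y" "y < z"
    and "x \<in> B \<inter> {..<u} - C" "z \<in> B \<inter> {..<u} - C" "y \<in> C - B \<inter> {..<u}"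
  then show False
    using ABA_freeD[OF assms(1), of B C x y z] by auto
next
  fix C x y z
  assume C: "C \<in> F" and xy: "x < y" and yz: "y < z"
    and x: "x \<in> C - B \<inter> {..<u}" and z: "z \<in> C - B \<inter> {..<u}" and y: "y \<in> B \<inter> {..<u} - C"
  have xB: "x \<notin> B" and yu: "y < u"
    using y xy x by auto
  show False
  proof (cases "z \<in> B")
    case False
    then show False
      using ABA_freeD[OF assms(1), of C B x y z] C x y z xB xy yz by auto
  next
    case True
    then have "u < z"
      using z assms(2) by (metis DiffD2 IntI lessThan_iff linorder_neqE)
    moreover have "x < u"
      using xy yu by (rule less_trans)
    ultimately have "u \<in> C"
      using assms(3) C x z unfolding skips_def by blast
    then show False
      using ABA_freeD[OF assms(1), of C B x y u] C y x xB xy yu assms(2) by auto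
  qed
qed

text \<open>Induction on \<open>F\<close> with \<open>X\<close> kept outside of it, so that the
  hypothesis for \<open>F\<close> also applies to the removed set \<open>B\<close> and to
  truncations of \<open>B\<close>. If \<open>B\<close> skips the vertex \<open>u\<close> found in
  \<open>X\<close>, the aim is a vertex of \<open>X \<inter> B\<close> unskipped by
  \<open>F\<close>.\<close>

lemma exists_unskippable:
  assumes "finite F" "ABA_free (insert X F)" "X \<noteq> {}"
  shows "\<exists>v\<in>X. \<forall>C\<in>F. \<not> skips C v"
  using assms
proof (induction F arbitrary: X rule: finite_induct)
  case empty
  then show ?case by blast
next
  case (insert B F)
  have "ABA_free (insert X F)"
    using insert.prems(1) by (rule ABA_free_subset) blast
  then obtain u where u: "u \<in> X" "\<forall>C\<in>F. \<not> skips C u"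
    using insert.IH insert.prems(2) by blast
  have BF: "ABA_free (insert B F)"
    using insert.prems(1) by (rule ABA_free_subset) blast
  \<comment> \<open>A set never skips its own elements, so membership in \<open>B\<close> takes care
    of the additional set.\<close>
  have good: ?case if "v \<in> X" "v \<in> B" "\<forall>C\<in>F. \<not> skips C v" for v
    using that unfolding skips_def by blast
  show ?case
  proof (cases "skips B u")
    case False
    then show ?thesis
      using u by blast
  next
    case True
    then have uB: "u \<notin> B" and "B \<noteq> {}"
      unfolding skips_def by auto
    then obtain v where v: "v \<in> B" "\<forall>C\<in>F. \<not> skips C v"
      using insert.IH BF by blast
    show ?thesis
    proof (cases "v \<in> X")
      case True
      then show ?thesis
        using good v by blast
    next
      case False
      \<comment> \<open>Beyond \<open>u\<close>, as seen from \<open>v\<close>, the set \<open>B\<close> is contained in \<open>X\<close>; cutting \<open>B\<close> at the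
        unskipped vertex \<open>u\<close> keeps the family ABA-free, so the induction hypothesis applies.\<close>
      from u(1) uB v(1) have "v \<noteq> u" by blast
      then consider "v < u" | "u < v"
        by (rule linorder_neqE)
      then show ?thesis
      proof cases
        case 1
        have "B \<inter> {u<..} \<noteq> {}"
          using True unfolding skips_def by blast
        then obtain w where w: "w \<in> B" "u < w" "\<forall>C\<in>F. \<not> skips C w"
          using insert.IH ABA_free_insert_Int_greaterThan[OF BF uB u(2)] by blast
        then have "w \<in> X"
          using ABA_freeD[OF insert.prems(1), of B X v u w] 1 u(1) v(1) False uB by auto
        then show ?thesis
          using good w by blast
      next
        case 2
        have "B \<inter> {..<u} \<noteq> {}"
          using True unfolding skips_def by blast
        then obtain w where w: "w \<in> B" "w < u" "\<forall>C\<in>F. \<not> skips C w"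
          using insert.IH ABA_free_insert_Int_lessThan[OF BF uB u(2)] by blast
        then have "w \<in> X"
          using ABA_freeD[OF insert.prems(1), of B X w u v] 2 u(1) v(1) False uB by auto
        then show ?thesis
          using good w by blast
      qed
    qed
  qed
qed

section \<open>Hitting sets of size three\<close>

text \<open>Missing both ends of \<open>V\<close> ensures that the trace of the minimal set has
  unskippable vertices on either side. Taking \<open>A = B\<close> in \<open>inter\<close> shows
  that all members of \<open>G\<close> are nonempty.\<close>

lemma hitting_set_if_extremes_missed:
  fixes V :: "'a::linorder set"
  assumes V: "finite V" "F \<subseteq> Pow V" and F: "ABA_free F"
    and G: "G \<subseteq> F \<union> complement_family V F"
    and inter: "\<And>A B. A \<in> G \<Longrightarrow> B \<in> G \<Longrightarrow> A \<inter> B \<noteq> {}"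
    and X0: "X0 \<in> G" "X0 \<in> F" "Min V \<notin> X0" "Max V \<notin> X0"
  shows "\<exists>K. K \<subseteq> V \<and> card K \<le> 3 \<and> (\<forall>S\<in>G. S \<inter> K \<noteq> {})"
proof -
  define T where "T = {v \<in> V. \<forall>C\<in>F. \<not> skips C v}"
  have "finite T" "finite F"
    using V finite_subset[of F "Pow V"] unfolding T_def by auto
  have "X0 \<noteq> {}"
    using inter X0(1) by blast
  then have "V \<noteq> {}"
    using X0(2) V(2) by blast
  have notskip: "v \<in> A" if "A \<in> F" "v \<in> T" "x \<in> A" "z \<in> A" "x < v" "v < z" for A v x z
    using that unfolding T_def skips_def by blast
  have trace: "\<exists>v\<in>T. v \<in> A" if "A \<in> F" "A \<noteq> {}" for A
  proof -
    have "ABA_free (insert A F)"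
      using F that(1) by (simp add: insert_absorb)
    then show ?thesis
      using exists_unskippable[OF \<open>finite F\<close> _ that(2)] that(1) V(2) unfolding T_def by blast
  qed
  have bounds: "Min V \<le> v" "v \<le> Max V" if "v \<in> V" for v
    using that V(1) by auto
  \<comment> \<open>A skipped vertex has vertices on both sides, which the ends of \<open>V\<close>
    lack.\<close>
  have ext: "Min V \<in> T" "Max V \<in> T"
    using V bounds \<open>V \<noteq> {}\<close> unfolding T_def skips_def by (auto simp: leD subset_iff)
  define P where "P X \<longleftrightarrow> X \<in> G \<and> X \<in> F \<and> Min V \<notin> X \<and> Max V \<notin> X" for X
  have "P X0"
    using X0 unfolding P_def by blast
  then obtain X where PX: "P X" and minimal: "\<And>X'. P X' \<Longrightarrow> card (X \<inter> T) \<le> card (X' \<inter> T)"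
    using exists_least_iff[of "\<lambda>k. \<exists>X. P X \<and> card (X \<inter> T) = k"] by (metis not_less)
  then have X: "X \<in> G" "X \<in> F" "Min V \<notin> X" "Max V \<notin> X"
    unfolding P_def by auto
  have "X \<noteq> {}"
    using inter X(1) by blast
  define a b where "a = Min (X \<inter> T)" and "b = Max (X \<inter> T)"
  have XT: "finite (X \<inter> T)" "X \<inter> T \<noteq> {}"
    using \<open>finite T\<close> trace[OF X(2) \<open>X \<noteq> {}\<close>] by auto
  have a: "a \<in> X" "a \<in> T" and b: "b \<in> X" "b \<in> T"
    using Min_in[OF XT] Max_in[OF XT] unfolding a_def b_def by auto
  have ab: "a \<le> v" "v \<le> b" if "v \<in> X" "v \<in> T" for v
    using that XT unfolding a_def b_def by auto
  have TV: "T \<subseteq> V"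
    unfolding T_def by blast
  \<comment> \<open>The unskippable vertices next to the whole trace: \<open>a'\<close> precedes its
    first vertex \<open>a\<close>, and \<open>b'\<close> follows its last vertex
    \<open>b\<close>.\<close>
  define a' b' where "a' = Max {t \<in> T. t < a}" and "b' = Min {t \<in> T. b < t}"
  have "Min V < a" "b < Max V"
    using a b X bounds[of a] bounds[of b] TV by (auto simp: order_le_less)
  then have ne: "{t \<in> T. t < a} \<noteq> {}" "{t \<in> T. b < t} \<noteq> {}"
    using ext by auto
  have a': "a' \<in> T" "a' < a" and b': "b' \<in> T" "b < b'"
    using Max_in[OF _ ne(1)] Min_in[OF _ ne(2)] \<open>finite T\<close> unfolding a'_def b'_def by auto
  have a'_max: "t \<le> a'" if "t \<in> T" "t < a" for t
    using that \<open>finite T\<close> unfolding a'_def by auto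
  have b'_min: "b' \<le> t" if "t \<in> T" "b < t" for t
    using that \<open>finite T\<close> unfolding b'_def by auto
  have a'X: "a' \<notin> X" and b'X: "b' \<notin> X"
    using ab[of a'] ab[of b'] a' b' by auto
  \<comment> \<open>An element of \<open>X\<close> left of \<open>a'\<close> would, together with
    \<open>a\<close>, make \<open>X\<close> skip \<open>a'\<close>; likewise for \<open>b\<close>
    and \<open>b'\<close>.\<close>
  have X_between: "a' < p" "p < b'" if "p \<in> X" for p
  proof -
    have "p \<noteq> a'" "p \<noteq> b'"
      using a'X b'X that by auto
    then show "a' < p" "p < b'"
      using notskip[OF X(2) a'(1) that a(1) _ a'(2)] notskip[OF X(2) b'(1) b(1) that b'(2)] a'X b'X
      by (auto simp: neq_iff)
  qed
  \<comment> \<open>By the choice of \<open>a'\<close> and \<open>b'\<close>, such a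
    \<open>t\<close> lies between \<open>a\<close> and \<open>b\<close>, and \<open>X\<close> cannot
    skip it.\<close>
  have T_between: "t \<in> X" if "t \<in> T" "a' < t" "t < b'" for t
  proof -
    have "a \<le> t" "t \<le> b"
      using that a'_max[of t] b'_min[of t] by (auto simp: not_le[symmetric])
    then show ?thesis
      using notskip[OF X(2) that(1) a(1) b(1)] a(1) b(1) by (auto simp: order_le_less)
  qed
  \<comment> \<open>A common element with \<open>X\<close> lies between \<open>a'\<close> and
    \<open>b'\<close>, and \<open>S\<close> skips neither, so all of \<open>S\<close> lies there.
    Its trace is thus contained in that of \<open>X\<close>, and minimality forces equality.\<close>
  have hit_F: "a \<in> S" if S: "S \<in> G" "S \<in> F" "a' \<notin> S" "b' \<notin> S" for S
  proof -
    obtain p where p: "p \<in> S" "p \<in> X"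
      using inter[OF S(1) X(1)] by blast
    have *: "a' < s \<and> s < b'" if "s \<in> S" for s
    proof -
      have "s \<noteq> a'" "s \<noteq> b'"
        using S(3,4) that by auto
      then show ?thesis
        using notskip[OF S(2) a'(1) that p(1)] notskip[OF S(2) b'(1) p(1) that]
          X_between[OF p(2)] S(3,4) by (auto simp: neq_iff)
    qed
    have sub: "S \<inter> T \<subseteq> X \<inter> T"
      using * T_between by blast
    moreover have "P S"
      using S(1,2) sub ext X(3,4) unfolding P_def by blast
    ultimately have "S \<inter> T = X \<inter> T"
      using minimal XT(1) card_seteq by blast
    then show ?thesis
      using a by blast
  qed
  \<comment> \<open>Otherwise \<open>Y\<close> contains \<open>a'\<close> and \<open>b'\<close>,
    while \<open>X\<close> misses both and has an element in \<open>S\<close>, hence outside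
    \<open>Y\<close>, between them: a forbidden pattern.\<close>
  have hit_complement: "a' \<in> S \<or> b' \<in> S" if S: "S \<in> G" "Y \<in> F" "S = V - Y" for S Y
  proof (rule ccontr)
    assume "\<not> (a' \<in> S \<or> b' \<in> S)"
    then have "a' \<in> Y" "b' \<in> Y"
      using S(3) a'(1) b'(1) TV by auto
    moreover obtain w where "w \<in> X" "w \<notin> Y"
      using inter[OF S(1) X(1)] S(3) by blast
    ultimately show False
      using ABA_freeD[OF F S(2) X(2), of a' w b'] X_between a'X b'X by blast
  qed
  have "\<forall>S\<in>G. S \<inter> {a', a, b'} \<noteq> {}"
  proof
    fix S assume S: "S \<in> G"
    show "S \<inter> {a', a, b'} \<noteq> {}"
    proof (cases "S \<in> F")
      case True
      then show ?thesis
        using hit_F S by blast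
    next
      case False
      then obtain Y where "Y \<in> F" "S = V - Y"
        using S G unfolding complement_family_def by blast
      then show ?thesis
        using hit_complement S by blast
    qed
  qed
  moreover have "{a', a, b'} \<subseteq> V"
    using a a' b' TV by auto
  moreover have "card {a', a, b'} \<le> 3"
    using card_insert_le_m1[of 3 "{a, b'}" a'] card_insert_le_m1[of 2 "{b'}" a] by simp
  ultimately show ?thesis
    by blast
qed

lemma pairwise_intersecting_hitting_set:
  fixes V :: "'a::linorder set"
  assumes V: "finite V" "V \<noteq> {}" "F \<subseteq> Pow V" and F: "ABA_free F"
    and G: "G \<subseteq> F \<union> complement_family V F"
    and inter: "\<And>A B. A \<in> G \<Longrightarrow> B \<in> G \<Longrightarrow> A \<inter> B \<noteq> {}"
  shows "\<exists>K. K \<subseteq> V \<and> card K \<le> 3 \<and> (\<forall>S\<in>G. S \<inter> K \<noteq> {})"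
proof (cases "\<forall>S\<in>G. S \<inter> {Min V, Max V} \<noteq> {}")
  case True
  moreover have "card {Min V, Max V} \<le> 3"
    using card_insert_le_m1[of 2 "{Max V}" "Min V"] by simp
  ultimately show ?thesis
    using V by (intro exI[of _ "{Min V, Max V}"]) auto
next
  case False
  then obtain X where X: "X \<in> G" "Min V \<notin> X" "Max V \<notin> X"
    by blast
  show ?thesis
  proof (cases "X \<in> F")
    case True
    show ?thesis
      using hitting_set_if_extremes_missed[OF V(1,3) F G inter X(1) True X(2,3)] .
  next
    case False
    then have X': "X \<in> complement_family V F"
      using X G by blast
    have sub: "complement_family V F \<subseteq> Pow V"
      unfolding complement_family_def by blast
    \<comment> \<open>Complementing twice gives back \<open>F\<close>, so the assumption on
      \<open>G\<close> is symmetric in \<open>F\<close> and its complement family.\<close>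
    have G': "G \<subseteq> complement_family V F \<union> complement_family V (complement_family V F)"
      using G by (simp add: complement_family_involutive[OF V(3)] Un_commute)
    show ?thesis
      using hitting_set_if_extremes_missed[OF V(1) sub ABA_free_complement_family[OF V(3) F] G'
          inter X(1) X' X(2,3)] .
  qed
qed

section \<open>From hitting the complements to covering by two hyperedges\<close>

theorem mainTheorem5:
  fixes V :: "'a::linorder set" and H :: "'a set set" and n :: nat
  assumes "finite V"
    and "card V = n"
    and "n \<ge> 3"
    and "pseudohalfplane_hypergraph V H"
    and "\<forall>T. T \<subseteq> V \<and> card T = 3 \<longrightarrow> (\<exists>A\<in>H. T \<subseteq> A)"
  shows "\<exists>S. S \<subseteq> H \<and> finite S \<and> card S \<le> 2 \<and> \<Union>S = V"
proof (rule ccontr)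
  assume none: "\<not> ?thesis"
  obtain F where F: "F \<subseteq> Pow V" "ABA_free F" and HF: "H \<subseteq> F \<union> complement_family V F"
    and HV: "H \<subseteq> Pow V"
    using assms(4) unfolding pseudohalfplane_hypergraph_def hypergraph_on_def by blast
  have "complement_family V H \<subseteq> complement_family V (F \<union> complement_family V F)"
    using HF by (rule complement_family_mono)
  also have "\<dots> = complement_family V F \<union> complement_family V (complement_family V F)"
    by (rule complement_family_Un)
  finally have GF: "complement_family V H \<subseteq> F \<union> complement_family V F"
    using complement_family_involutive[OF F(1)] by (simp add: Un_commute)
  \<comment> \<open>The case \<open>A = B\<close> is included: a single hyperedge does not cover
    \<open>V\<close> either.\<close>
  have uncovered: "(V - A) \<inter> (V - B) \<noteq> {}" if "A \<in> H" "B \<in> H" for A B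
  proof
    assume disj: "(V - A) \<inter> (V - B) = {}"
    have "A \<subseteq> V" "B \<subseteq> V"
      using that HV by auto
    then have "\<Union>{A, B} = V"
      using disj by auto
    moreover have "card {A, B} \<le> 2"
      using card_insert_le_m1[of 2 "{B}" A] by simp
    moreover have "{A, B} \<subseteq> H"
      using that by simp
    ultimately have "\<exists>S. S \<subseteq> H \<and> finite S \<and> card S \<le> 2 \<and> \<Union>S = V"
      by (intro exI[of _ "{A, B}"]) simp
    with none show False ..
  qed
  have inter: "A \<inter> B \<noteq> {}" if "A \<in> complement_family V H" "B \<in> complement_family V H" for A B
    using that uncovered unfolding complement_family_def by auto
  have "V \<noteq> {}"
    using assms(2,3) by auto
  then obtain K where K: "K \<subseteq> V" "card K \<le> 3" "\<forall>S\<in>complement_family V H. S \<inter> K \<noteq> {}"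
    using pairwise_intersecting_hitting_set[OF assms(1) _ F GF inter] by auto
  \<comment> \<open>\<open>K\<close> is padded to exactly three vertices, which is possible as
    \<open>n \<ge> 3\<close>. The complement of a hyperedge containing \<open>T\<close> then avoids
    \<open>K\<close>.\<close>
  obtain T where T: "K \<subseteq> T" "T \<subseteq> V" "card T = 3"
    using exists_subset_between[OF K(2) _ K(1) assms(1)] assms(2,3) by blast
  then obtain A where "A \<in> H" "T \<subseteq> A"
    using assms(5) by blast
  then have "V - A \<in> complement_family V H"
    unfolding complement_family_def by blast
  with K(3) have "(V - A) \<inter> K \<noteq> {}" ..
  then show False
    using T(1) \<open>T \<subseteq> A\<close> by blast
qed

end
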